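(* Let $p$ be a prime with $p\equiv-1\pmod 8$, and let $\mathcal{D}_1,\mathcal{D}_2,\mathcal{E}_1,\mathcal{E}_2$ be the quadratic residue codes of length $p$ over $R$ defined below. Then: (i) $\mathcal{D}_i\mu_a=\mathcal{D}_i$ and $\mathcal{E}_i\mu_a=\mathcal{E}_i$ for $i=1,2$ and $a\in\mathcal{Q}_p$; $\mathcal{D}_1\mu_a=\mathcal{D}_2$ and $\mathcal{E}_1\mu_a=\mathcal{E}_2$ for $a\in\mathcal{N}_p$; (ii) $\mathcal{D}_1\cap\mathcal{D}_2=(J(X))$ and $\mathcal{D}_1+\mathcal{D}_2=R_p$; (iii) $\mathcal{E}_1\cap\mathcal{E}_2=\{0\}$ and $\mathcal{E}_1+\mathcal{E}_2=(J(X))^\perp$; (iv) $|\mathcal{D}_1|=|\mathcal{D}_2|=4^{p+1}$ and $|\mathcal{E}_1|=|\mathcal{E}_2|=4^{p-1}$; (v) $\mathcal{D}_i=\mathcal{E}_i+(J(X))$ for $i=1,2$; (vi) $\mathcal{E}_1,\mathcal{E}_2$ are Euclidean self-orthogonal and $\mathcal{E}_i^\perp=\mathcal{D}_i$ for $i=1,2$.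
   Context: $R=\mathbb{Z}_4[v]/(v^2-v)$, $R_p=R[X]/(X^p-1)$, vectors of $R^p$ identified with elements of $R_p$; $(f)$ denotes the ideal (cyclic code) generated by $f$. $\mathcal{Q}_p$ is the set of nonzero quadratic residues mod $p$, $\mathcal{N}_p$ the set of quadratic non-residues. $Q(X)=\sum_{i\in\mathcal{Q}_p}X^i$, $N(X)=\sum_{i\in\mathcal{N}_p}X^i$, $J(X)=p\sum_{i=0}^{p-1}X^i$. For an integer $a$ coprime to $p$, $\mu_a$ maps $\sum_ic_iX^i\mapsto\sum_ic_iX^{ai}$ (exponents mod $p$), and $\mathcal{C}\mu_a$ is the image of $\mathcal{C}$. Euclidean dual $\mathcal{C}^\perp=\{\mathbf{x}:\sum_ix_ic_i=0\ \forall\mathbf{c}\in\mathcal{C}\}$; self-orthogonal means $\mathcal{C}\subseteq\mathcal{C}^\perp$. Case I ($p\equiv-1\pmod 8$), write $p+1=8r$. If $r$ is odd: $\mathcal{D}_1=(v(Q+2N)+(1-v)(N+2Q))$, $\mathcal{D}_2=(v(N+2Q)+(1-v)(Q+2N))$, $\mathcal{E}_1=(v(1-N+2Q)+(1-v)(1-Q+2N))$, $\mathcal{E}_2=(v(1-Q+2N)+(1-v)(1-N+2Q))$. If $r$ is even: $\mathcal{D}_1=(-vQ-(1-v)N)$, $\mathcal{D}_2=(-vN-(1-v)Q)$, $\mathcal{E}_1=(v(1+N)+(1-v)(1+Q))$, $\mathcal{E}_2=(v(1+Q)+(1-v)(1+N))$. *)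

theory Defs
  imports "HOL-Library.Numeral_Type" "HOL-Number_Theory.Cong"
begin

section \<open>The ring R = Z4[v]/(v^2 - v)\<close>

text \<open>An element Rv a b represents a + b v with a, b in Z4 (the type 4).
  Multiplication: (a + b v)(c + d v) = ac + (ad + bc + bd) v, using v^2 = v.\<close>

datatype Rv = Rv "4" "4"

fun rv_fst :: "Rv \<Rightarrow> 4" where "rv_fst (Rv a b) = a"
fun rv_snd :: "Rv \<Rightarrow> 4" where "rv_snd (Rv a b) = b"

lemma Rv_eq_iff: "x = y \<longleftrightarrow> rv_fst x = rv_fst y \<and> rv_snd x = rv_snd y"
  by (cases x; cases y) auto

instantiation Rv :: comm_ring_1
begin
definition "0 = Rv 0 0"
definition "1 = Rv 1 0"
definition "x + y = Rv (rv_fst x + rv_fst y) (rv_snd x + rv_snd y)"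
definition "x - y = Rv (rv_fst x - rv_fst y) (rv_snd x - rv_snd y)"
definition "- x = Rv (- rv_fst x) (- rv_snd x)"
definition "x * y = Rv (rv_fst x * rv_fst y)
    (rv_fst x * rv_snd y + rv_snd x * rv_fst y + rv_snd x * rv_snd y)"
instance
  by standard (simp_all add: Rv_eq_iff zero_Rv_def one_Rv_def plus_Rv_def minus_Rv_def
      uminus_Rv_def times_Rv_def algebra_simps)
end

definition vv :: Rv where "vv = Rv 0 1"

section \<open>R_p = R[X]/(X^p - 1), elements as coefficient vectors of length p\<close>

text \<open>An element of R_p is a function c :: nat \<Rightarrow> Rv with c i = 0 for i \<ge> p
  (c i is the coefficient of X^i); this is also the vector (c 0, ..., c (p-1)) in R^p.\<close>

definition Rp :: "nat \<Rightarrow> (nat \<Rightarrow> Rv) set" where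
  "Rp p = {c. \<forall>i\<ge>p. c i = 0}"

definition cmul :: "nat \<Rightarrow> (nat \<Rightarrow> Rv) \<Rightarrow> (nat \<Rightarrow> Rv) \<Rightarrow> (nat \<Rightarrow> Rv)" where
  "cmul p f g = (\<lambda>k. if k < p then (\<Sum>i<p. \<Sum>j<p. if (i + j) mod p = k then f i * g j else 0) else 0)"

definition gen_ideal :: "nat \<Rightarrow> (nat \<Rightarrow> Rv) \<Rightarrow> (nat \<Rightarrow> Rv) set" where
  "gen_ideal p f = {cmul p g f | g. g \<in> Rp p}"

definition mu :: "nat \<Rightarrow> nat \<Rightarrow> (nat \<Rightarrow> Rv) \<Rightarrow> (nat \<Rightarrow> Rv)" where
  "mu p a c = (\<lambda>k. if k < p then (\<Sum>i<p. if (a * i) mod p = k then c i else 0) else 0)"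

definition code_sum :: "(nat \<Rightarrow> Rv) set \<Rightarrow> (nat \<Rightarrow> Rv) set \<Rightarrow> (nat \<Rightarrow> Rv) set" where
  "code_sum C D = {(\<lambda>i. x i + y i) | x y. x \<in> C \<and> y \<in> D}"

definition dual :: "nat \<Rightarrow> (nat \<Rightarrow> Rv) set \<Rightarrow> (nat \<Rightarrow> Rv) set" where
  "dual p C = {x \<in> Rp p. \<forall>c\<in>C. (\<Sum>i<p. x i * c i) = 0}"

definition self_orthogonal :: "nat \<Rightarrow> (nat \<Rightarrow> Rv) set \<Rightarrow> bool" where
  "self_orthogonal p C \<longleftrightarrow> C \<subseteq> dual p C"

definition QR :: "nat \<Rightarrow> nat set" where
  "QR p = {i. 0 < i \<and> i < p \<and> (\<exists>x. [x^2 = i] (mod p))}"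

definition NR :: "nat \<Rightarrow> nat set" where
  "NR p = {i. 0 < i \<and> i < p} - QR p"

definition Qpol :: "nat \<Rightarrow> nat \<Rightarrow> Rv" where
  "Qpol p = (\<lambda>k. if k \<in> QR p then 1 else 0)"

definition Npol :: "nat \<Rightarrow> nat \<Rightarrow> Rv" where
  "Npol p = (\<lambda>k. if k \<in> NR p then 1 else 0)"

definition Jpol :: "nat \<Rightarrow> nat \<Rightarrow> Rv" where
  "Jpol p = (\<lambda>k. if k < p then of_nat p else 0)"

definition onep :: "nat \<Rightarrow> Rv" where
  "onep = (\<lambda>k. if k = 0 then 1 else 0)"

text \<open>Case I: p \<equiv> -1 mod 8, r = (p+1)/8.\<close>
definition rr :: "nat \<Rightarrow> nat" where "rr p = (p + 1) div 8"

definition D1 :: "nat \<Rightarrow> (nat \<Rightarrow> Rv) set" where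
  "D1 p = (let Q = Qpol p; N = Npol p in
     if odd (rr p) then
       gen_ideal p (\<lambda>k. vv * (Q k + 2 * N k) + (1 - vv) * (N k + 2 * Q k))
     else gen_ideal p (\<lambda>k. - vv * Q k - (1 - vv) * N k))"

definition D2 :: "nat \<Rightarrow> (nat \<Rightarrow> Rv) set" where
  "D2 p = (let Q = Qpol p; N = Npol p in
     if odd (rr p) then
       gen_ideal p (\<lambda>k. vv * (N k + 2 * Q k) + (1 - vv) * (Q k + 2 * N k))
     else gen_ideal p (\<lambda>k. - vv * N k - (1 - vv) * Q k))"

definition E1 :: "nat \<Rightarrow> (nat \<Rightarrow> Rv) set" where
  "E1 p = (let Q = Qpol p; N = Npol p in
     if odd (rr p) then
       gen_ideal p (\<lambda>k. vv * (onep k - N k + 2 * Q k) + (1 - vv) * (onep k - Q k + 2 * N k))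
     else gen_ideal p (\<lambda>k. vv * (onep k + N k) + (1 - vv) * (onep k + Q k)))"

definition E2 :: "nat \<Rightarrow> (nat \<Rightarrow> Rv) set" where
  "E2 p = (let Q = Qpol p; N = Npol p in
     if odd (rr p) then
       gen_ideal p (\<lambda>k. vv * (onep k - Q k + 2 * N k) + (1 - vv) * (onep k - N k + 2 * Q k))
     else gen_ideal p (\<lambda>k. vv * (onep k + Q k) + (1 - vv) * (onep k + N k)))"

end

theory Submission
  imports Defs "HOL-Library.Function_Algebras" "HOL-Number_Theory.Euler_Criterion"
begin

text \<open>
  Write Q and N for the indicator functions of residues and non-residues, multiplied by cyclic
  convolution. For a prime p = 4c + 3 one has Q Q = c Q + (c + 1) N, Q N = (2c + 1) + c (Q + N), and
  N N is obtained from Q Q by exchanging Q and N. These products are found over the integers: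
  each product is invariant under dilation by a residue, hence is a combination of 1, Q and N; its
  coefficients are determined by its value at 0, the sum of all its coefficients, and the
  associativity of Q Q N.

  Over R, where 4 = 0, they show that the generators g, h of D1, D2 are idempotents
  with g h = J and g + h = 1 + J, while 1 - h and 1 - g generate E1 and E2. Dilation by a
  non-residue exchanges g and h. All claims except the cardinalities are then computations with these
  idempotents; in particular the dual of (e) is the annihilator of the dilation of e by -1, and -1 is
  a non-residue. The cardinalities follow from the direct sums R_p = E1 + D2 and D_i = E_i + (J).
\<close>

section \<open>Cyclic convolution and dilation\<close>

text \<open>The coefficient ring is left general because the products of quadratic periods are computed over
  the integers, where one can cancel, and only then reduced to R.\<close>

definition conv :: "nat \<Rightarrow> (nat \<Rightarrow> 'a::comm_ring_1) \<Rightarrow> (nat \<Rightarrow> 'a) \<Rightarrow> nat \<Rightarrow> 'a" where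
  "conv p f g = (\<lambda>k. if k < p then \<Sum>i<p. \<Sum>j<p. if (i + j) mod p = k then f i * g j else 0 else 0)"

definition dil :: "nat \<Rightarrow> nat \<Rightarrow> (nat \<Rightarrow> 'a::comm_ring_1) \<Rightarrow> nat \<Rightarrow> 'a" where
  "dil p a f = (\<lambda>k. if k < p then \<Sum>i<p. if (a * i) mod p = k then f i else 0 else 0)"

definition dirac :: "nat \<Rightarrow> 'a::comm_ring_1" where
  "dirac k = (if k = 0 then 1 else 0)"

lemma cmul_conv: "cmul p = conv p"
  by (simp add: fun_eq_iff cmul_def conv_def)

lemma mu_dil: "mu p a = dil p a"
  by (simp add: fun_eq_iff mu_def dil_def)

lemma onep_dirac: "onep = dirac"
  by (simp add: fun_eq_iff onep_def dirac_def)

lemma conv_outside [simp]: "p \<le> k \<Longrightarrow> conv p f g k = 0"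
  by (simp add: conv_def)

lemma dil_outside [simp]: "p \<le> k \<Longrightarrow> dil p a f k = 0"
  by (simp add: dil_def)

text \<open>A test function \<open>\<phi>\<close> turns a convolution into a double sum over
  residues mod \<open>p\<close>; below it is a point mass or the constant 1.\<close>

lemma sum_mult_conv:
  "(\<Sum>k<p. \<phi> k * conv p f g k) = (\<Sum>i<p. \<Sum>j<p. \<phi> ((i + j) mod p) * (f i * g j))"
proof -
  have "(\<Sum>k<p. \<phi> k * conv p f g k)
      = (\<Sum>k<p. \<Sum>i<p. \<Sum>j<p. if (i + j) mod p = k then \<phi> k * (f i * g j) else 0)"
    by (simp add: conv_def sum_distrib_left if_distrib cong: if_cong)
  also have "\<dots> = (\<Sum>i<p. \<Sum>k<p. \<Sum>j<p. if (i + j) mod p = k then \<phi> k * (f i * g j) else 0)"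
    by (rule sum.swap)
  also have "\<dots> = (\<Sum>i<p. \<Sum>j<p. \<Sum>k<p. if (i + j) mod p = k then \<phi> k * (f i * g j) else 0)"
    by (intro sum.cong sum.swap refl)
  also have "\<dots> = (\<Sum>i<p. \<Sum>j<p. \<phi> ((i + j) mod p) * (f i * g j))"
    by (intro sum.cong refl) auto
  finally show ?thesis .
qed

lemma sum_mult_dil:
  "(\<Sum>k<p. \<phi> k * dil p a f k) = (\<Sum>i<p. \<phi> (a * i mod p) * f i)"
proof -
  have "(\<Sum>k<p. \<phi> k * dil p a f k)
      = (\<Sum>k<p. \<Sum>i<p. if a * i mod p = k then \<phi> k * f i else 0)"
    by (simp add: dil_def sum_distrib_left if_distrib cong: if_cong)
  also have "\<dots> = (\<Sum>i<p. \<Sum>k<p. if a * i mod p = k then \<phi> k * f i else 0)"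
    by (rule sum.swap)
  also have "\<dots> = (\<Sum>i<p. \<phi> (a * i mod p) * f i)"
    by (intro sum.cong refl) auto
  finally show ?thesis .
qed

lemma conv_comm: "conv p f g = conv p g f"
proof
  fix k
  show "conv p f g k = conv p g f k"
    unfolding conv_def by (subst sum.swap) (simp add: add.commute mult.commute cong: if_cong)
qed

text \<open>The triple sum treats the three factors alike, so associativity becomes a reordering of
  sums.\<close>

lemma conv_conv_apply:
  assumes "k < p"
  shows "conv p (conv p f g) h k =
    (\<Sum>i<p. \<Sum>j<p. \<Sum>l<p. if (i + j + l) mod p = k then f i * g j * h l else 0)"
proof -
  have "conv p (conv p f g) h k
      = (\<Sum>l<p. \<Sum>m<p. (if (m + l) mod p = k then h l else 0) * conv p f g m)"
    using assms unfolding conv_def[of p "conv p f g"]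
    by (simp, subst sum.swap) (intro sum.cong refl, simp add: mult.commute)
  also have "\<dots> = (\<Sum>l<p. \<Sum>i<p. \<Sum>j<p. (if ((i + j) mod p + l) mod p = k then h l else 0) * (f i * g j))"
    by (simp only: sum_mult_conv)
  also have "\<dots> = (\<Sum>i<p. \<Sum>l<p. \<Sum>j<p. (if ((i + j) mod p + l) mod p = k then h l else 0) * (f i * g j))"
    by (rule sum.swap)
  also have "\<dots> = (\<Sum>i<p. \<Sum>j<p. \<Sum>l<p. (if ((i + j) mod p + l) mod p = k then h l else 0) * (f i * g j))"
    by (intro sum.cong sum.swap refl)
  also have "\<dots> = (\<Sum>i<p. \<Sum>j<p. \<Sum>l<p. if (i + j + l) mod p = k then f i * g j * h l else 0)"
    by (intro sum.cong refl) (simp add: mod_simps mult_ac)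
  finally show ?thesis .
qed

lemma conv_assoc: "conv p (conv p f g) h = conv p f (conv p g h)"
proof
  fix k
  show "conv p (conv p f g) h k = conv p f (conv p g h) k"
  proof (cases "k < p")
    case True
    let ?t = "\<lambda>i j l. if (i + j + l) mod p = k then f i * g j * h l else 0"
    have "conv p f (conv p g h) k = conv p (conv p g h) f k"
      by (simp add: conv_comm)
    also have "\<dots> = (\<Sum>j<p. \<Sum>l<p. \<Sum>i<p. ?t i j l)"
      unfolding conv_conv_apply[OF True]
      by (intro sum.cong refl) (auto simp: add_ac mult_ac)
    also have "\<dots> = (\<Sum>j<p. \<Sum>i<p. \<Sum>l<p. ?t i j l)"
      by (intro sum.cong sum.swap refl)
    also have "\<dots> = (\<Sum>i<p. \<Sum>j<p. \<Sum>l<p. ?t i j l)"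
      by (rule sum.swap)
    finally show ?thesis
      by (simp add: conv_conv_apply True)
  qed simp
qed

lemma conv_add_left: "conv p (f + g) h = conv p f h + conv p g h"
  by (auto simp: fun_eq_iff conv_def distrib_right sum.distrib[symmetric] intro!: sum.cong)

lemma conv_add_right: "conv p h (f + g) = conv p h f + conv p h g"
  by (simp add: conv_comm[of p h] conv_add_left)

lemma conv_diff_left: "conv p (f - g) h = conv p f h - conv p g h"
  by (auto simp: fun_eq_iff conv_def left_diff_distrib sum_subtractf[symmetric] intro!: sum.cong)

lemma conv_diff_right: "conv p h (f - g) = conv p h f - conv p h g"
  by (simp add: conv_comm[of p h] conv_diff_left)

lemma conv_smult_left: "conv p (\<lambda>k. c * f k) g = (\<lambda>k. c * conv p f g k)"
  by (auto simp: fun_eq_iff conv_def sum_distrib_left mult.assoc intro!: sum.cong)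

lemma conv_smult_right: "conv p g (\<lambda>k. c * f k) = (\<lambda>k. c * conv p g f k)"
  by (simp add: conv_comm[of p g] conv_smult_left)

lemma conv_zero_left [simp]: "conv p 0 f = 0"
  by (simp add: fun_eq_iff conv_def cong: if_cong)

lemma conv_dirac_left:
  assumes "\<forall>i\<ge>p. f i = 0"
  shows "conv p dirac f = f"
proof
  fix k
  show "conv p dirac f k = f k"
  proof (cases "k < p")
    case True
    have "conv p dirac f k = (\<Sum>i<p. if i = 0 then \<Sum>j<p. if j = k then f j else 0 else 0)"
    proof -
      have "(\<Sum>j<p. if (i + j) mod p = k then dirac i * f j else 0)
          = (if i = 0 then \<Sum>j<p. if j = k then f j else 0 else 0)" for i
        by (cases "i = 0") (auto simp: dirac_def intro!: sum.cong sum.neutral)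
      then show ?thesis
        using True by (simp add: conv_def)
    qed
    also have "\<dots> = f k"
      using True by simp
    finally show ?thesis .
  qed (use assms in simp)
qed

lemma conv_dirac_right: "\<forall>i\<ge>p. f i = 0 \<Longrightarrow> conv p f dirac = f"
  by (simp add: conv_comm[of p f] conv_dirac_left)

text \<open>For fixed \<open>k\<close> each \<open>i\<close> has exactly one partner
  \<open>j\<close>, so every coefficient of \<open>f\<close> is counted once.\<close>

lemma conv_const_right:
  "conv p f (\<lambda>k. if k < p then c else 0) = (\<lambda>k. if k < p then (\<Sum>i<p. f i) * c else 0)"
proof
  fix k
  show "conv p f (\<lambda>k. if k < p then c else 0) k = (if k < p then (\<Sum>i<p. f i) * c else 0)"
  proof (cases "k < p")
    case True
    have "(\<Sum>j<p. if (i + j) mod p = k then f i * c else 0) = f i * c" if "i < p" for i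
    proof -
      \<comment> \<open>\<open>k + (p - i)\<close> is \<open>k - i\<close> mod \<open>p\<close>
        without leaving the naturals.\<close>
      have "(i + j) mod p = k \<longleftrightarrow> j = (k + (p - i)) mod p" if "j < p" for j
      proof
        assume "(i + j) mod p = k"
        then have "(k + (p - i)) mod p = (i + j + (p - i)) mod p"
          by (metis mod_add_left_eq)
        also have "i + j + (p - i) = j + p" using \<open>i < p\<close> by simp
        finally show "j = (k + (p - i)) mod p" using that by simp
      next
        assume "j = (k + (p - i)) mod p"
        then have "(i + j) mod p = (i + (k + (p - i))) mod p"
          by (metis mod_add_right_eq)
        also have "i + (k + (p - i)) = k + p" using \<open>i < p\<close> by simp
        finally show "(i + j) mod p = k" using True by simp
      qed
      then have "(\<Sum>j<p. if (i + j) mod p = k then f i * c else 0)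
          = (\<Sum>j<p. if j = (k + (p - i)) mod p then f i * c else 0)"
        by (intro sum.cong) auto
      also have "\<dots> = f i * c" using True by simp
      finally show ?thesis .
    qed
    then show ?thesis
      using True by (simp add: conv_def sum_distrib_right cong: if_cong)
  qed simp
qed

section \<open>Dilation as a ring endomorphism\<close>

lemma dil_add: "dil p a (f + g) = dil p a f + dil p a g"
  by (auto simp: fun_eq_iff dil_def sum.distrib[symmetric] intro!: sum.cong)

lemma dil_diff: "dil p a (f - g) = dil p a f - dil p a g"
  by (auto simp: fun_eq_iff dil_def sum_subtractf[symmetric] intro!: sum.cong)

lemma dil_smult: "dil p a (\<lambda>k. c * f k) = (\<lambda>k. c * dil p a f k)"
  by (auto simp: fun_eq_iff dil_def sum_distrib_left intro!: sum.cong)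

text \<open>Multiplication by \<open>a\<close> is additive mod \<open>p\<close>, so pushing forward
  the product or both factors gives the same double sum.\<close>

lemma dil_conv: "dil p a (conv p f g) = conv p (dil p a f) (dil p a g)"
proof
  fix k
  show "dil p a (conv p f g) k = conv p (dil p a f) (dil p a g) k"
  proof (cases "k < p")
    case True
    let ?\<delta> = "\<lambda>n. if n mod p = k then 1 else 0 :: 'a"
    have "dil p a (conv p f g) k = (\<Sum>m<p. ?\<delta> (a * m) * conv p f g m)"
      using True unfolding dil_def by (auto intro!: sum.cong)
    also have "\<dots> = (\<Sum>i<p. \<Sum>j<p. ?\<delta> (a * i + a * j) * (f i * g j))"
      by (simp add: sum_mult_conv mod_simps distrib_left)
    finally have l: "dil p a (conv p f g) k = \<dots>" .
    have "conv p (dil p a f) (dil p a g) k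
        = (\<Sum>i<p. (\<Sum>j<p. ?\<delta> (i + j) * dil p a g j) * dil p a f i)"
      using True unfolding conv_def by (auto simp: sum_distrib_right intro!: sum.cong)
    also have "\<dots> = (\<Sum>i<p. (\<Sum>j<p. ?\<delta> (a * i mod p + a * j mod p) * g j) * f i)"
      by (simp only: sum_mult_dil)
    also have "\<dots> = (\<Sum>i<p. \<Sum>j<p. ?\<delta> (a * i + a * j) * (f i * g j))"
      by (auto simp: sum_distrib_left sum_distrib_right mod_simps mult_ac intro!: sum.cong)
    finally show ?thesis using l by simp
  qed simp
qed

lemma dil_dil: "dil p a (dil p b f) = dil p (a * b) f"
proof
  fix k
  show "dil p a (dil p b f) k = dil p (a * b) f k"
  proof (cases "k < p")
    case True
    let ?\<delta> = "\<lambda>n. if n mod p = k then 1 else 0 :: 'a"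
    have "dil p a (dil p b f) k = (\<Sum>m<p. ?\<delta> (a * m) * dil p b f m)"
      using True unfolding dil_def[of p a] by (auto intro!: sum.cong)
    also have "\<dots> = (\<Sum>i<p. ?\<delta> (a * (b * i)) * f i)"
      by (simp add: sum_mult_dil mod_simps)
    also have "\<dots> = dil p (a * b) f k"
      using True unfolding dil_def by (auto simp: mult_ac intro!: sum.cong)
    finally show ?thesis .
  qed simp
qed

lemma dil_cong_one:
  assumes "[c = 1] (mod p)" "\<forall>i\<ge>p. f i = 0"
  shows "dil p c f = f"
proof
  fix k
  have "c * i mod p = i" if "i < p" for i
    using cong_mult[OF assms(1) cong_refl[of i p]] that by (simp add: cong_def)
  then show "dil p c f k = f k"
    using assms(2) by (cases "k < p") (simp_all add: dil_def)
qed

lemma dil_apply: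
  assumes "coprime a p" "i < p"
  shows "dil p a f (a * i mod p) = f i"
proof -
  have "a * j mod p = a * i mod p \<longleftrightarrow> j = i" if "j < p" for j
    using assms that cong_mult_lcancel_nat[of a p j i] by (auto simp: cong_def)
  then have "dil p a f (a * i mod p) = (\<Sum>j<p. if j = i then f j else 0)"
    using assms(2) by (auto simp: dil_def intro!: sum.cong)
  also have "\<dots> = f i" using assms(2) by simp
  finally show ?thesis .
qed

lemma mult_mod_surj:
  fixes a :: nat
  assumes "coprime a p" "k < p"
  obtains i where "i < p" "a * i mod p = k"
proof -
  obtain b where "[a * b = 1] (mod p)"
    using cong_solve_coprime_nat[OF assms(1)] by auto
  then have "[a * b * k = 1 * k] (mod p)"
    by (intro cong_mult) auto
  then have "a * (b * k mod p) mod p = k"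
    using assms(2) by (simp add: cong_def mod_simps mult_ac)
  then show ?thesis
    using that[of "b * k mod p"] assms(2) by simp
qed

lemma dil_dirac:
  assumes "coprime a p" "0 < p"
  shows "dil p a dirac = dirac"
proof
  fix k
  show "dil p a dirac k = (dirac k :: 'a)"
  proof (cases "k < p")
    case True
    then obtain i where i: "i < p" "a * i mod p = k" using mult_mod_surj assms(1) by blast
    have "k = 0 \<longleftrightarrow> p dvd a * i" using i(2) by auto
    also have "\<dots> \<longleftrightarrow> i = 0"
      using assms i(1) by (metis coprime_commute coprime_dvd_mult_right_iff dvd_0_right gr0I nat_dvd_not_less)
    finally show ?thesis
      using dil_apply[OF assms(1) i(1), of "dirac :: nat \<Rightarrow> 'a"] i(2) by (simp add: dirac_def)
  qed (use assms in \<open>simp add: dirac_def\<close>)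
qed

text \<open>Dilation by \<open>p - 1\<close> is the reversal \<open>i \<mapsto> -i\<close>, so the
  coefficient at 0 pairs equal indices. This turns duals into annihilators.\<close>

lemma sum_mult_eq_conv:
  assumes "0 < p"
  shows "(\<Sum>i<p. x i * c i) = conv p x (dil p (p - 1) c) 0"
proof -
  have eq: "i = j \<longleftrightarrow> (i + (p - 1) * j mod p) mod p = 0" if "i < p" "j < p" for i j
  proof -
    have "(i + (p - 1) * j mod p) mod p = 0 \<longleftrightarrow> [i + (p - 1) * j = 0] (mod p)"
      by (simp add: cong_def mod_simps)
    also have "\<dots> \<longleftrightarrow> [i + (p - 1) * j + j = 0 + j] (mod p)"
      by (simp only: cong_add_rcancel_nat)
    also have "i + (p - 1) * j + j = i + p * j"
      using that by (cases p) simp_all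
    also have "[i + p * j = 0 + j] (mod p) \<longleftrightarrow> i = j"
      using that by (simp add: cong_def)
    finally show ?thesis by simp
  qed
  have "conv p x (dil p (p - 1) c) 0
      = (\<Sum>i<p. x i * (\<Sum>j<p. (if (i + j) mod p = 0 then 1 else 0) * dil p (p - 1) c j))"
    using assms unfolding conv_def by (auto simp: sum_distrib_left intro!: sum.cong)
  also have "\<dots> = (\<Sum>i<p. x i * (\<Sum>j<p. (if (i + (p - 1) * j mod p) mod p = 0 then 1 else 0) * c j))"
    by (simp only: sum_mult_dil)
  also have "\<dots> = (\<Sum>i<p. x i * (\<Sum>j<p. if j = i then c j else 0))"
  proof (intro sum.cong refl arg_cong2[of _ _ _ _ "(*)"])
    fix i j assume "i \<in> {..<p}" "j \<in> {..<p}"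
    then show "(if (i + (p - 1) * j mod p) mod p = 0 then 1 else 0) * c j = (if j = i then c j else 0)"
      by (simp only: lessThan_iff eq[symmetric]) simp
  qed
  also have "\<dots> = (\<Sum>i<p. x i * c i)"
    by simp
  finally show ?thesis by simp
qed

text \<open>Generic in the ring: the period identities use it at \<open>int\<close>, the codes at
  \<open>Rv\<close>.\<close>

definition chi :: "nat set \<Rightarrow> nat \<Rightarrow> 'a::comm_ring_1" where
  "chi A k = (if k \<in> A then 1 else 0)"

lemma chi_cong: "(a \<in> A \<longleftrightarrow> b \<in> B) \<Longrightarrow> chi A a = chi B b"
  by (simp add: chi_def)

lemma chi_mult_self [simp]: "chi A k * chi A k = chi A k"
  by (simp add: chi_def)

lemma sum_conv: "(\<Sum>k<p. conv p f g k) = (\<Sum>i<p. f i) * (\<Sum>j<p. g j)"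
  using sum_mult_conv[of "\<lambda>_. 1" p f g] by (simp add: sum_product)

lemma sum_dil: "(\<Sum>k<p. dil p a f k) = (\<Sum>i<p. f i)"
  using sum_mult_dil[of "\<lambda>_. 1" p a f] by simp

lemma of_int_conv: "of_int (conv p f g k) = conv p (\<lambda>i. of_int (f i)) (\<lambda>i. of_int (g i)) k"
  by (auto simp: conv_def intro!: sum.cong)

section \<open>Products of quadratic periods\<close>

locale prime_3_mod_4 =
  fixes p :: nat
  assumes prime_p: "prime p" and p_mod_4: "p mod 4 = 3"
begin

lemma p_gt_2: "p > 2"
  using p_mod_4 by (cases "p \<le> 2") (auto simp: le_Suc_eq numeral_2_eq_2)

section \<open>Multiplicativity of the residue classes\<close>

lemma QR_lt: "k \<in> QR p \<Longrightarrow> 0 < k \<and> k < p"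
  and NR_lt: "k \<in> NR p \<Longrightarrow> 0 < k \<and> k < p"
  by (auto simp: QR_def NR_def)

lemma QR_NR_disjoint: "k \<in> QR p \<Longrightarrow> k \<notin> NR p"
  by (simp add: NR_def)

lemma NR_iff: "0 < k \<Longrightarrow> k < p \<Longrightarrow> k \<in> NR p \<longleftrightarrow> k \<notin> QR p"
  by (simp add: NR_def)

lemma coprime_p: "0 < k \<Longrightarrow> k < p \<Longrightarrow> coprime k p"
  using prime_p by (metis coprime_commute nat_dvd_not_less prime_imp_coprime)

lemma QR_iff_QuadRes:
  assumes "0 < i" "i < p"
  shows "i \<in> QR p \<longleftrightarrow> QuadRes (int p) (int i)"
proof
  assume "i \<in> QR p"
  then obtain x where "[x\<^sup>2 = i] (mod p)" by (auto simp: QR_def)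
  then have "[(int x)\<^sup>2 = int i] (mod int p)"
    by (metis cong_int_iff of_nat_power)
  then show "QuadRes (int p) (int i)" by (auto simp: QuadRes_def)
next
  assume "QuadRes (int p) (int i)"
  then obtain y where "[y\<^sup>2 = int i] (mod int p)" by (auto simp: QuadRes_def)
  then have "[int (nat (y mod int p) ^ 2) = int i] (mod int p)"
    using p_gt_2 by (simp add: cong_def power_mod)
  then have "[nat (y mod int p) ^ 2 = i] (mod p)"
    by (simp only: cong_int_iff)
  then show "i \<in> QR p" using assms by (auto simp: QR_def)
qed

lemma euler:
  assumes "0 < i" "i < p"
  shows "[int i ^ ((p - 1) div 2) = (if i \<in> QR p then 1 else -1)] (mod int p)"
proof -
  have "\<not> [int i = 0] (mod int p)"
    using assms by (simp add: cong_def)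
  then have "Legendre (int i) (int p) = (if i \<in> QR p then 1 else -1)"
    using QR_iff_QuadRes[OF assms] by (simp add: Legendre_def)
  then show ?thesis
    using euler_criterion[OF prime_p, of "int i"] p_gt_2 by (metis cong_sym)
qed

lemma not_cong_1_minus_1: "\<not> [1 = -1] (mod int p)"
  using p_gt_2 by (auto simp: cong_iff_dvd_diff dest!: zdvd_imp_le)

lemma mult_mod_range:
  assumes "0 < a" "a < p" "0 < i" "i < p"
  shows "0 < a * i mod p" "a * i mod p < p"
proof -
  have "\<not> p dvd a * i"
    using assms prime_p by (simp add: prime_dvd_mult_iff nat_dvd_not_less)
  then show "0 < a * i mod p" by (simp add: dvd_eq_mod_eq_0)
qed (use assms in simp)

text \<open>Euler's criterion turns membership into the sign of a \<open>(p - 1) div 2\<close>-th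
  power; powers multiply, and 1 and -1 are distinct mod \<open>p\<close>.\<close>

lemma mult_mod_QR:
  assumes "0 < a" "a < p" "0 < i" "i < p"
  shows "a * i mod p \<in> QR p \<longleftrightarrow> (a \<in> QR p \<longleftrightarrow> i \<in> QR p)"
proof -
  let ?m = "(p - 1) div 2"
  let ?e = "\<lambda>k. if k \<in> QR p then 1 else -1 :: int"
  have "[?e (a * i mod p) = int (a * i mod p) ^ ?m] (mod int p)"
    using euler mult_mod_range[OF assms] cong_sym by blast
  also have "[int (a * i mod p) ^ ?m = (int a * int i) ^ ?m] (mod int p)"
    by (intro cong_pow) (simp add: zmod_int)
  also have "(int a * int i) ^ ?m = int a ^ ?m * int i ^ ?m"
    by (rule power_mult_distrib)
  also have "[\<dots> = ?e a * ?e i] (mod int p)"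
    using assms by (intro cong_mult euler)
  finally show ?thesis
    using not_cong_1_minus_1 cong_sym[of "-1" 1 "int p"] by (auto split: if_splits)
qed

lemma mult_mod_NR:
  assumes "0 < a" "a < p" "0 < i" "i < p"
  shows "a * i mod p \<in> NR p \<longleftrightarrow> (a \<in> QR p \<longleftrightarrow> i \<in> NR p)"
  using mult_mod_QR[OF assms] mult_mod_range[OF assms] assms by (simp add: NR_iff)

text \<open>For \<open>p = 4c + 3\<close> the exponent \<open>(p - 1) div 2 = 2c + 1\<close> in
  Euler's criterion is odd.\<close>

lemma minus_one_NR: "p - 1 \<in> NR p"
proof -
  have "p = 4 * (p div 4) + 3" using p_mod_4 by presburger
  then have "(p - 1) div 2 = 2 * (p div 4) + 1" by linarith
  then have odd: "odd ((p - 1) div 2)" by simp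
  have "[int (p - 1) = -1] (mod int p)"
    using p_gt_2 by (simp add: cong_iff_dvd_diff of_nat_diff)
  then have "[int (p - 1) ^ ((p - 1) div 2) = (-1) ^ ((p - 1) div 2)] (mod int p)"
    by (rule cong_pow)
  then have "[int (p - 1) ^ ((p - 1) div 2) = -1] (mod int p)"
    using odd by simp
  then have "p - 1 \<notin> QR p"
    using euler[of "p - 1"] p_gt_2 not_cong_1_minus_1 cong_trans[OF cong_sym] by fastforce
  then show ?thesis using p_gt_2 by (simp add: NR_iff)
qed

section \<open>Action of dilation on the residue classes\<close>

lemma chi_outside:
  "p \<le> k \<Longrightarrow> chi (QR p) k = 0" "p \<le> k \<Longrightarrow> chi (NR p) k = 0"
  using QR_lt NR_lt by (fastforce simp: chi_def)+

lemma dil_eqI: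
  assumes "0 < a" "a < p" "\<And>i. i < p \<Longrightarrow> g (a * i mod p) = f i" "\<And>k. p \<le> k \<Longrightarrow> g k = 0"
  shows "dil p a f = g"
proof
  fix k
  show "dil p a f k = g k"
  proof (cases "k < p")
    case True
    then obtain i where "i < p" "a * i mod p = k"
      using mult_mod_surj coprime_p assms(1,2) by metis
    then show ?thesis
      using dil_apply[OF coprime_p[OF assms(1,2)], of i f] assms(3) by auto
  qed (use assms(4) in simp)
qed

lemma zero_notin: "0 \<notin> QR p" "0 \<notin> NR p"
  using QR_lt NR_lt by blast+

text \<open>Multiplication by a residue preserves the two classes, by a non-residue it exchanges
  them; index 0 is fixed and lies in neither.\<close>

lemma dil_chi:
  assumes "0 < a" "a < p"
  shows "dil p a (chi (QR p)) = chi (if a \<in> QR p then QR p else NR p)"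
    and "dil p a (chi (NR p)) = chi (if a \<in> QR p then NR p else QR p)"
proof -
  have "a * i mod p \<in> QR p \<longleftrightarrow> i \<in> (if a \<in> QR p then QR p else NR p)"
    "a * i mod p \<in> NR p \<longleftrightarrow> i \<in> (if a \<in> QR p then NR p else QR p)" if "i < p" for i
    using mult_mod_QR[OF assms _ that] mult_mod_NR[OF assms _ that] zero_notin NR_iff[OF _ that]
    by (cases "i = 0"; simp)+
  \<comment> \<open>The conditional moves to the image side, as a push-forward requires; the
    exchange is its own inverse.\<close>
  then have "a * i mod p \<in> (if a \<in> QR p then QR p else NR p) \<longleftrightarrow> i \<in> QR p"
    "a * i mod p \<in> (if a \<in> QR p then NR p else QR p) \<longleftrightarrow> i \<in> NR p" if "i < p" for i
    using that by (auto split: if_splits)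
  then show "dil p a (chi (QR p)) = chi (if a \<in> QR p then QR p else NR p)"
    "dil p a (chi (NR p)) = chi (if a \<in> QR p then NR p else QR p)"
    using assms by (auto intro!: dil_eqI chi_cong simp: chi_outside split del: if_split) (auto simp: chi_outside)
qed

lemma dil_QR:
  assumes "a \<in> QR p"
  shows "dil p a (chi (QR p)) = chi (QR p)" "dil p a (chi (NR p)) = chi (NR p)"
  using assms QR_lt[OF assms] by (simp_all add: dil_chi)

lemma dil_NR:
  assumes "a \<in> NR p"
  shows "dil p a (chi (QR p)) = chi (NR p)" "dil p a (chi (NR p)) = chi (QR p)"
  using assms NR_lt[OF assms] QR_NR_disjoint by (auto simp: dil_chi)

lemma dirac_outside: "p \<le> k \<Longrightarrow> dirac k = 0"
  using p_gt_2 by (simp add: dirac_def)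

text \<open>Multiplication by residues has three orbits on the indices, represented by 0, 1 and
  \<open>p - 1\<close>; an invariant function is constant on each.\<close>

lemma invariant_decomp:
  assumes inv: "\<And>a. a \<in> QR p \<Longrightarrow> dil p a h = h" and "\<And>k. p \<le> k \<Longrightarrow> h k = 0"
  shows "h = (\<lambda>k. h 0 * dirac k + h 1 * chi (QR p) k + h (p - 1) * chi (NR p) k)"
proof
  fix k
  have orbit: "h (a * i mod p) = h i" if "a \<in> QR p" "i < p" for a i
    using dil_apply[OF coprime_p, of a i h] inv[OF that(1)] QR_lt[OF that(1)] that by simp
  consider "p \<le> k" | "k = 0" | "k \<in> QR p" | "k \<in> NR p"
    using NR_iff[of k] by fastforce
  then show "h k = h 0 * dirac k + h 1 * chi (QR p) k + h (p - 1) * chi (NR p) k"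
  proof cases
    case 1
    then show ?thesis by (simp add: chi_outside dirac_outside assms(2))
  next
    case 2
    then show ?thesis using zero_notin by (simp add: chi_def dirac_def)
  next
    case 3
    then show ?thesis
      using orbit[OF 3, of 1] QR_lt[OF 3] QR_NR_disjoint p_gt_2 by (simp add: chi_def dirac_def)
  next
    case 4
    note k = NR_lt[OF 4]
    \<comment> \<open>\<open>?a\<close> is \<open>-k\<close>, a residue since \<open>k\<close> and
      -1 are non-residues; multiplying it by -1 gives back \<open>k\<close>.\<close>
    let ?a = "k * (p - 1) mod p"
    have "?a \<in> QR p"
      using mult_mod_QR[of k "p - 1"] k 4 minus_one_NR p_gt_2 QR_NR_disjoint by auto
    then have "h (?a * (p - 1) mod p) = h (p - 1)"
      using p_gt_2 by (intro orbit) auto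
    also have "?a * (p - 1) mod p = k * ((p - 1) * (p - 1)) mod p"
      by (simp add: mod_simps mult.assoc)
    also have "(p - 1) * (p - 1) = p * (p - 2) + 1"
      using p_gt_2 by (cases p rule: nat.exhaust; cases "p - 1"; simp)
    also have "k * (p * (p - 2) + 1) mod p = k"
      using k by (simp add: distrib_left mult.left_commute[of k p])
    finally show ?thesis
      using k 4 QR_NR_disjoint by (auto simp: chi_def dirac_def)
  qed
qed

text \<open>The c with \<open>p = 4c + 3\<close>, from which all coefficients of the products below
  are built.\<close>

definition period_const :: nat where
  "period_const = (p - 3) div 4"

lemma p_period_const: "p = 4 * period_const + 3"
  using p_mod_4 p_gt_2 unfolding period_const_def by presburger

lemma period_identities_int:
  "conv p (chi (QR p)) (chi (QR p)) =
    (\<lambda>k. of_nat period_const * chi (QR p) k + (of_nat period_const + 1) * chi (NR p) k :: int)"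
  "conv p (chi (QR p)) (chi (NR p)) =
    (\<lambda>k. (2 * of_nat period_const + 1) * dirac k + of_nat period_const * (chi (QR p) k + chi (NR p) k) :: int)"
proof -
  let ?q = "chi (QR p) :: nat \<Rightarrow> int" and ?n = "chi (NR p) :: nat \<Rightarrow> int"
  define s where "s = (\<Sum>k<p. ?q k)"
  \<comment> \<open>The second pair has \<open>1\<close> as \<open>Suc 0\<close>, the form the
    simplifier produces.\<close>
  note nr = dil_NR[OF minus_one_NR] dil_NR[OF minus_one_NR[unfolded One_nat_def]]
  have p0: "0 < p" using p_gt_2 by simp
  have sn: "(\<Sum>k<p. ?n k) = s"
    using sum_dil[of p "p - 1" ?q] by (simp only: nr s_def)
  have "(\<Sum>k<p. dirac k + ?q k + ?n k) = (\<Sum>k<p. 1)"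
    using NR_iff zero_notin by (intro sum.cong) (auto simp: dirac_def chi_def)
  moreover have "(\<Sum>k<p. dirac k) = (1 :: int)"
    using p0 by (simp add: dirac_def)
  ultimately have p_s: "int p = 1 + 2 * s"
    using sn by (simp add: sum.distrib s_def)
  define a where "a = conv p ?q ?q 1"
  define b where "b = conv p ?q ?q (p - 1)"
  define c where "c = conv p ?q ?n 1"
  \<comment> \<open>The coefficient of a product at 0 is an inner product with the reversed factor,
    and reversal exchanges the classes: hence 0 for the two squares and \<open>s\<close> for the
    mixed product.\<close>
  have qq0: "conv p ?q ?q 0 = 0"
    using sum_mult_eq_conv[OF p0, of ?q ?n] QR_NR_disjoint
    by (simp add: nr chi_def sum.neutral)
  have nn0: "conv p ?n ?n 0 = 0"
    using sum_mult_eq_conv[OF p0, of ?n ?q] QR_NR_disjoint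
    by (simp add: nr chi_def sum.neutral)
  have qn0: "conv p ?q ?n 0 = s"
    using sum_mult_eq_conv[OF p0, of ?q ?q]
    by (simp add: nr s_def)
  \<comment> \<open>Reversal exchanges the factors of this product, so its values at 1 and -1
    agree.\<close>
  have c': "conv p ?q ?n (p - 1) = c"
  proof -
    have "dil p (p - 1) (conv p ?q ?n) ((p - 1) * 1 mod p) = conv p ?q ?n 1"
      using p_gt_2 by (intro dil_apply coprime_p) auto
    then show ?thesis
      using p_gt_2 by (simp add: dil_conv nr c_def conv_comm[of p ?n])
  qed
  have qq: "conv p ?q ?q = (\<lambda>k. a * ?q k + b * ?n k)"
    using invariant_decomp[of "conv p ?q ?q"] by (simp add: dil_conv dil_QR qq0 a_def b_def)
  have qn: "conv p ?q ?n = (\<lambda>k. s * dirac k + c * ?q k + c * ?n k)"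
    using invariant_decomp[of "conv p ?q ?n"] unfolding c' qn0
    by (simp add: dil_conv dil_QR c_def)
  have s: "s \<noteq> 0"
    using p_s p_gt_2 by auto
  \<comment> \<open>The sum of all coefficients is multiplicative; the nonzero integer
    \<open>s\<close> then cancels.\<close>
  have "s * s = s * (a + b)"
    using sum_conv[where f = ?q and g = ?q and p = p] unfolding qq
    by (simp add: sum.distrib sum_distrib_left[symmetric] sn s_def[symmetric] algebra_simps)
  then have ab: "s = a + b" using s by simp
  have "s * s = s * (1 + 2 * c)"
    using sum_conv[where f = ?q and g = ?n and p = p] p0 unfolding qn
    by (simp add: sum.distrib sum_distrib_left[symmetric] sn s_def[symmetric] algebra_simps dirac_def)
  then have sc: "s = 1 + 2 * c" using s by simp
  \<comment> \<open>\<open>a = c\<close>: compare the two bracketings of the coefficient of \<open>?q ?q ?n\<close> at 0.\<close>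
  have e1: "conv p (conv p ?q ?q) ?n 0 = a * s"
  proof -
    have "conv p ?q ?q = (\<lambda>k. a * ?q k) + (\<lambda>k. b * ?n k)"
      by (simp add: qq fun_eq_iff)
    then show ?thesis
      by (simp add: conv_add_left conv_smult_left qn0 nn0)
  qed
  have e2: "conv p ?q (conv p ?q ?n) 0 = c * s"
  proof -
    have "conv p ?q ?n = (\<lambda>k. s * dirac k) + (\<lambda>k. c * ?q k) + (\<lambda>k. c * ?n k)"
      by (simp add: qn fun_eq_iff)
    then show ?thesis
      using zero_notin
      by (simp add: conv_add_right conv_smult_right qn0 qq0 conv_dirac_right chi_outside)
        (simp add: chi_def dirac_def)
  qed
  have ac: "a = c" using e1 e2 s by (simp add: conv_assoc)
  \<comment> \<open>\<open>p = 1 + 2s\<close> and \<open>s = 1 + 2c\<close> give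
    \<open>p = 4c + 3\<close>.\<close>
  have "c = of_nat period_const" using p_s sc p_period_const by linarith
  then show "conv p ?q ?q = (\<lambda>k. of_nat period_const * ?q k + (of_nat period_const + 1) * ?n k)"
    "conv p ?q ?n = (\<lambda>k. (2 * of_nat period_const + 1) * dirac k + of_nat period_const * (?q k + ?n k))"
    using ab sc ac by (simp_all add: qq qn fun_eq_iff algebra_simps)
qed

lemma of_int_chi: "of_int (chi A k) = chi A k"
  by (simp add: chi_def)

lemma of_int_dirac: "of_int (dirac k) = dirac k"
  by (simp add: dirac_def)

lemma conv_QR_QR:
  "conv p (chi (QR p)) (chi (QR p)) = (\<lambda>k. of_nat period_const * chi (QR p) k + (of_nat period_const + 1) * chi (NR p) k)"
proof
  fix k
  show "conv p (chi (QR p)) (chi (QR p)) k = (of_nat period_const * chi (QR p) k + (of_nat period_const + 1) * chi (NR p) k :: 'a)"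
    using arg_cong[OF fun_cong[OF period_identities_int(1), of k], of "of_int :: int \<Rightarrow> 'a"]
    by (simp add: of_int_conv of_int_chi del: of_int_eq_iff)
qed

lemma conv_QR_NR:
  "conv p (chi (QR p)) (chi (NR p)) =
    (\<lambda>k. (2 * of_nat period_const + 1) * dirac k + of_nat period_const * (chi (QR p) k + chi (NR p) k))"
proof
  fix k
  show "conv p (chi (QR p)) (chi (NR p)) k =
    ((2 * of_nat period_const + 1) * dirac k + of_nat period_const * (chi (QR p) k + chi (NR p) k) :: 'a)"
    using arg_cong[OF fun_cong[OF period_identities_int(2), of k], of "of_int :: int \<Rightarrow> 'a"]
    by (simp add: of_int_conv of_int_chi of_int_dirac)
qed

lemma conv_NR_NR:
  "conv p (chi (NR p)) (chi (NR p)) = (\<lambda>k. of_nat period_const * chi (NR p) k + (of_nat period_const + 1) * chi (QR p) k)"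
proof -
  let ?d = "dil p (p - 1)"
  have "conv p (chi (NR p)) (chi (NR p)) = ?d (conv p (chi (QR p)) (chi (QR p)))"
    by (simp only: dil_conv dil_NR minus_one_NR)
  also have "\<dots> = ?d ((\<lambda>k. of_nat period_const * chi (QR p) k) + (\<lambda>k. (of_nat period_const + 1) * chi (NR p) k))"
    by (simp add: conv_QR_QR plus_fun_def)
  also have "\<dots> = (\<lambda>k. of_nat period_const * chi (NR p) k + (of_nat period_const + 1) * chi (QR p) k)"
    unfolding dil_add dil_smult dil_NR[OF minus_one_NR] by (simp add: plus_fun_def)
  finally show ?thesis .
qed

text \<open>The multiplication table extended bilinearly: products of generators reduce to comparing
  three coefficients.\<close>

lemma conv_QR_NR_comb:
  "conv p (\<lambda>k. a * chi (QR p) k + b * chi (NR p) k) (\<lambda>k. c * chi (QR p) k + d * chi (NR p) k) =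
    (\<lambda>k. (a * d + b * c) * (2 * of_nat period_const + 1) * dirac k
      + (a * c * of_nat period_const + (a * d + b * c) * of_nat period_const + b * d * (of_nat period_const + 1)) * chi (QR p) k
      + (a * c * (of_nat period_const + 1) + (a * d + b * c) * of_nat period_const + b * d * of_nat period_const) * chi (NR p) k)"
proof -
  have split: "(\<lambda>k. x * chi (QR p) k + y * chi (NR p) k)
      = (\<lambda>k. x * chi (QR p) k) + (\<lambda>k. y * chi (NR p) k)" for x y :: 'a
    by (simp add: fun_eq_iff)
  show ?thesis
    unfolding split conv_add_left conv_add_right conv_smult_left conv_smult_right
      conv_QR_QR conv_NR_NR conv_QR_NR conv_comm[of p "chi (NR p)" "chi (QR p)"]
    by (simp add: fun_eq_iff algebra_simps)
qed

end

section \<open>Ideals generated by idempotents\<close>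

lemma Rp_iff: "x \<in> Rp p \<longleftrightarrow> (\<forall>i\<ge>p. x i = 0)"
  by (simp add: Rp_def)

lemma conv_Rp [simp]: "conv p x y \<in> Rp p"
  by (simp add: Rp_def)

lemma dil_Rp [simp]: "dil p a x \<in> Rp p"
  by (simp add: Rp_def)

lemma zero_Rp [simp]: "0 \<in> Rp p"
  by (simp add: Rp_def)

lemma add_Rp [simp]: "x \<in> Rp p \<Longrightarrow> y \<in> Rp p \<Longrightarrow> x + y \<in> Rp p"
  by (simp add: Rp_def)

lemma diff_Rp [simp]: "x \<in> Rp p \<Longrightarrow> y \<in> Rp p \<Longrightarrow> x - y \<in> Rp p"
  by (simp add: Rp_def)

lemma dirac_Rp: "0 < p \<Longrightarrow> dirac \<in> Rp p"
  by (simp add: Rp_def dirac_def)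

lemma gen_ideal_conv: "gen_ideal p f = (\<lambda>x. conv p x f) ` Rp p"
  by (auto simp: gen_ideal_def cmul_conv)

lemma gen_ideal_Rp: "gen_ideal p f \<subseteq> Rp p"
  by (auto simp: gen_ideal_conv)

lemma gen_ideal_diff: "x \<in> gen_ideal p f \<Longrightarrow> y \<in> gen_ideal p f \<Longrightarrow> x - y \<in> gen_ideal p f"
  by (auto simp: gen_ideal_conv conv_diff_left[symmetric])

text \<open>Multiplication by an idempotent is a projection, so its image is its fixed set and
  membership becomes an equation.\<close>

lemma gen_ideal_idem:
  assumes "conv p e e = e"
  shows "gen_ideal p e = {x \<in> Rp p. conv p x e = x}"
proof (intro equalityI subsetI)
  fix x assume "x \<in> {x \<in> Rp p. conv p x e = x}"
  then show "x \<in> gen_ideal p e"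
    unfolding gen_ideal_conv by (intro image_eqI[of _ _ x]) auto
qed (auto simp: gen_ideal_conv conv_assoc assms)

lemma code_sum_plus: "code_sum C D = {x + y | x y. x \<in> C \<and> y \<in> D}"
  by (simp add: code_sum_def plus_fun_def)

text \<open>Trivial intersection makes the two summands unique, so addition is injective on
  pairs.\<close>

lemma card_code_sum:
  assumes "\<And>x y. x \<in> C \<Longrightarrow> y \<in> C \<Longrightarrow> x - y \<in> C" "\<And>x y. x \<in> D \<Longrightarrow> y \<in> D \<Longrightarrow> x - y \<in> D"
    and "C \<inter> D \<subseteq> {0}"
  shows "card (code_sum C D) = card C * card D"
proof -
  have "inj_on (\<lambda>(x, y). x + y) (C \<times> D)"
  proof (rule inj_onI, clarsimp)
    fix x y x' y' assume a: "x \<in> C" "y \<in> D" "x' \<in> C" "y' \<in> D" "x + y = x' + y'"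
    then have "x - x' = y' - y" by (simp add: algebra_simps)
    then have "x - x' \<in> C \<inter> D" using assms(1)[of x x'] assms(2)[of y' y] a by auto
    then have "x - x' = 0" using assms(3) by blast
    then show "x = x' \<and> y = y'" using a(5) by simp
  qed
  moreover have "code_sum C D = (\<lambda>(x, y). x + y) ` (C \<times> D)"
    by (auto simp: code_sum_plus)
  ultimately show ?thesis
    by (simp add: card_image card_cartesian_product)
qed

text \<open>For \<open>a\<close> invertible mod \<open>p\<close>, dilation is a ring endomorphism
  that maps \<open>Rp p\<close> onto itself.\<close>

lemma dil_image_gen_ideal:
  assumes "coprime a p"
  shows "dil p a ` gen_ideal p f = gen_ideal p (dil p a f)"
proof -
  obtain b where b: "[a * b = 1] (mod p)"
    using cong_solve_coprime_nat[OF assms] by auto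
  have "Rp p \<subseteq> dil p a ` Rp p"
  proof
    fix x assume "x \<in> Rp p"
    then have "x = dil p a (dil p b x)"
      using b by (simp add: dil_dil dil_cong_one Rp_iff)
    then show "x \<in> dil p a ` Rp p"
      using dil_Rp by (rule image_eqI)
  qed
  then have "Rp p = dil p a ` Rp p" by auto
  moreover have "dil p a ` gen_ideal p f = (\<lambda>x. conv p x (dil p a f)) ` dil p a ` Rp p"
    by (simp add: gen_ideal_conv image_image dil_conv)
  ultimately show ?thesis
    by (simp add: gen_ideal_conv)
qed

text \<open>The adjoint of multiplication by \<open>f\<close> is multiplication by the reversed
  \<open>f\<close>, and the inner product is nondegenerate, as unit vectors show.\<close>

lemma dual_gen_ideal:
  assumes "0 < p"
  shows "dual p (gen_ideal p f) = {x \<in> Rp p. conv p x (dil p (p - 1) f) = 0}"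
proof -
  have inner: "(\<Sum>i<p. x i * conv p y f i) = (\<Sum>i<p. conv p x (dil p (p - 1) f) i * y i)" for x y
    unfolding sum_mult_eq_conv[OF assms] dil_conv conv_assoc
    by (simp only: conv_comm[of p "dil p (p - 1) y" "dil p (p - 1) f"])
  have "conv p x (dil p (p - 1) f) = 0"
    if "\<forall>y\<in>Rp p. (\<Sum>i<p. conv p x (dil p (p - 1) f) i * y i) = 0" for x
  proof
    fix k
    let ?z = "conv p x (dil p (p - 1) f)"
    show "?z k = 0 k"
    proof (cases "k < p")
      case True
      then have "chi {k} \<in> Rp p" by (auto simp: Rp_def chi_def)
      then have "(\<Sum>i<p. ?z i * chi {k} i) = 0" using that by blast
      moreover have "(\<Sum>i<p. ?z i * chi {k} i) = (\<Sum>i<p. if i = k then ?z i else 0)"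
        by (intro sum.cong refl) (simp add: chi_def)
      ultimately show ?thesis using True by simp
    qed simp
  qed
  then show ?thesis
    unfolding dual_def gen_ideal_conv ball_simps inner by (intro Collect_cong) auto
qed

text \<open>The quadratic residue codes are D1 = (g), D2 = (h), E1 = (1 - h), E2 = (1 - g).\<close>

locale splitting =
  fixes p :: nat and g h J :: "nat \<Rightarrow> Rv"
  assumes p_pos: "0 < p" and g_Rp: "g \<in> Rp p" and h_Rp: "h \<in> Rp p"
    and gg: "conv p g g = g" and hh: "conv p h h = h"
    and gh: "conv p g h = J" and g_plus_h: "g + h = dirac + J"
begin

text \<open>The conditions are symmetric in \<open>g\<close> and \<open>h\<close>, so each fact
  below also serves the other pair of codes.\<close>

lemma swap: "splitting p h g J"
  using p_pos g_Rp h_Rp gg hh gh g_plus_h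
  by unfold_locales (simp_all add: conv_comm[of p h g] add.commute)

lemma conv_J: "conv p x J = conv p (conv p x g) h" "conv p x J = conv p (conv p x h) g"
  by (simp_all add: gh[symmetric] conv_assoc conv_comm[of p g h])

lemma Jg: "conv p J g = J" and Jh: "conv p J h = J" and JJ: "conv p J J = J"
proof -
  show Jg: "conv p J g = J"
    using conv_J(1)[of g] by (simp add: conv_comm[of p J g] gg gh)
  show Jh: "conv p J h = J"
    using conv_J(2)[of h] by (simp add: conv_comm[of p J h] conv_comm[of p h g] hh gh)
  show "conv p J J = J"
    using conv_J(1)[of J] by (simp add: Jg Jh)
qed

text \<open>Inclusion-exclusion from \<open>g + h = 1 + J\<close>: the overlap \<open>x J\<close> is
  counted twice.\<close>

lemma expand: "x \<in> Rp p \<Longrightarrow> conv p x g + conv p x h = x + conv p x J"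
  by (simp add: conv_add_right[symmetric] g_plus_h) (simp add: conv_add_right conv_dirac_right Rp_iff)

lemma conv_compl: "x \<in> Rp p \<Longrightarrow> conv p x (dirac - y) = x - conv p x y"
  by (simp add: Rp_iff conv_diff_right conv_dirac_right)

lemma mem_g: "x \<in> gen_ideal p g \<longleftrightarrow> x \<in> Rp p \<and> conv p x g = x"
  and mem_h: "x \<in> gen_ideal p h \<longleftrightarrow> x \<in> Rp p \<and> conv p x h = x"
  and mem_J: "x \<in> gen_ideal p J \<longleftrightarrow> x \<in> Rp p \<and> conv p x J = x"
  by (simp_all add: gen_ideal_idem gg hh JJ)

text \<open>With \<open>h\<close> also \<open>1 - h\<close> is idempotent, and
  \<open>x (1 - h) = x\<close> says \<open>x h = 0\<close>.\<close>

lemma mem_compl_h: "x \<in> gen_ideal p (dirac - h) \<longleftrightarrow> x \<in> Rp p \<and> conv p x h = 0"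
proof -
  have "conv p (dirac - h) (dirac - h) = dirac - h"
    using h_Rp dirac_Rp[OF p_pos]
    by (simp add: conv_compl) (simp add: conv_diff_left hh Rp_iff conv_dirac_left)
  then show ?thesis
    by (auto simp: gen_ideal_idem conv_compl)
qed

lemma mem_compl_g: "x \<in> gen_ideal p (dirac - g) \<longleftrightarrow> x \<in> Rp p \<and> conv p x g = 0"
  by (rule splitting.mem_compl_h[OF swap])

text \<open>The product \<open>J\<close> of two commuting idempotents projects onto the intersection
  of their ideals.\<close>

lemma ideal_inter: "gen_ideal p g \<inter> gen_ideal p h = gen_ideal p J"
proof (intro equalityI subsetI)
  fix x assume "x \<in> gen_ideal p J"
  then have x: "x \<in> Rp p" "conv p x J = x" by (auto simp: mem_J)
  then show "x \<in> gen_ideal p g \<inter> gen_ideal p h"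
    by (metis IntI Jg Jh conv_assoc mem_g mem_h)
qed (auto simp: mem_g mem_h mem_J conv_J(1))

lemma ideal_sum: "code_sum (gen_ideal p g) (gen_ideal p h) = Rp p"
proof (intro equalityI subsetI)
  fix x assume x: "x \<in> Rp p"
  have "x = conv p x g + (conv p x h - conv p x J)"
    using expand[OF x] by (simp add: algebra_simps)
  moreover have "conv p x g \<in> gen_ideal p g" by (simp add: mem_g conv_assoc gg)
  moreover have "conv p x h - conv p x J \<in> gen_ideal p h"
    by (simp add: mem_h conv_diff_left conv_assoc hh Jh)
  ultimately show "x \<in> code_sum (gen_ideal p g) (gen_ideal p h)"
    by (auto simp: code_sum_plus)
qed (auto simp: code_sum_plus mem_g mem_h)

lemma compl_inter: "gen_ideal p (dirac - h) \<inter> gen_ideal p (dirac - g) = {0}"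
proof (intro equalityI subsetI)
  fix x assume "x \<in> gen_ideal p (dirac - h) \<inter> gen_ideal p (dirac - g)"
  then have "x \<in> Rp p" "conv p x h = 0" "conv p x g = 0"
    by (auto simp: mem_compl_g mem_compl_h)
  then show "x \<in> {0}"
    using expand[of x] by (simp add: conv_J(1))
qed (auto simp: mem_compl_g mem_compl_h)

text \<open>The right-hand side is the annihilator of \<open>J\<close>, later identified with the
  dual of \<open>(J)\<close>; on it \<open>x g + x h = x\<close>.\<close>

lemma compl_sum: "code_sum (gen_ideal p (dirac - h)) (gen_ideal p (dirac - g)) = {x \<in> Rp p. conv p x J = 0}"
proof (intro equalityI subsetI)
  fix x assume "x \<in> {x \<in> Rp p. conv p x J = 0}"
  then have x: "x \<in> Rp p" "conv p x J = 0" by auto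
  have "x = (x - conv p x h) + (x - conv p x g)"
    using expand[OF x(1)] x(2) by (simp add: algebra_simps)
  moreover have "x - conv p x h \<in> gen_ideal p (dirac - h)" "x - conv p x g \<in> gen_ideal p (dirac - g)"
    using x(1) by (simp_all add: mem_compl_h mem_compl_g conv_diff_left conv_assoc gg hh)
  ultimately show "x \<in> code_sum (gen_ideal p (dirac - h)) (gen_ideal p (dirac - g))"
    unfolding code_sum_plus by blast
next
  fix x assume "x \<in> code_sum (gen_ideal p (dirac - h)) (gen_ideal p (dirac - g))"
  then obtain y z where "x = y + z" "y \<in> Rp p" "z \<in> Rp p" "conv p y h = 0" "conv p z g = 0"
    by (auto simp: code_sum_plus mem_compl_h mem_compl_g)
  then show "x \<in> {x \<in> Rp p. conv p x J = 0}"
    by (simp add: conv_add_left conv_J(2)[of y] conv_J(1)[of z])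
qed

text \<open>If \<open>x h = 0\<close> then \<open>x J = 0\<close>, and \<open>expand\<close> leaves
  \<open>x g = x\<close>. Once the duals are known, this is self-orthogonality.\<close>

lemma compl_subset: "gen_ideal p (dirac - h) \<subseteq> gen_ideal p g"
proof
  fix x assume "x \<in> gen_ideal p (dirac - h)"
  then have "x \<in> Rp p" "conv p x h = 0" by (auto simp: mem_compl_h)
  then show "x \<in> gen_ideal p g"
    using expand[of x] by (simp add: mem_g conv_J(2))
qed

lemma ideal_decomp: "gen_ideal p g = code_sum (gen_ideal p (dirac - h)) (gen_ideal p J)"
proof (intro equalityI subsetI)
  fix x assume "x \<in> gen_ideal p g"
  then have x: "x \<in> Rp p" "conv p x g = x" by (auto simp: mem_g)
  \<comment> \<open>On \<open>(g)\<close>, multiplication by \<open>h\<close> agrees with that by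
    \<open>J = g h\<close>, so the \<open>h\<close>-part of \<open>x\<close> lies in
    \<open>(J)\<close>.\<close>
  then have xJ: "conv p x J = conv p x h" by (simp add: conv_J(1))
  have "x = (x - conv p x h) + conv p x h" by simp
  moreover have "x - conv p x h \<in> gen_ideal p (dirac - h)"
    using x by (simp add: mem_compl_h conv_diff_left conv_assoc hh)
  moreover have "conv p x h \<in> gen_ideal p J"
    unfolding xJ[symmetric] by (simp add: mem_J conv_assoc JJ)
  ultimately show "x \<in> code_sum (gen_ideal p (dirac - h)) (gen_ideal p J)"
    unfolding code_sum_plus by blast
next
  fix x assume "x \<in> code_sum (gen_ideal p (dirac - h)) (gen_ideal p J)"
  then obtain y z where "x = y + z" "y \<in> gen_ideal p g" "z \<in> gen_ideal p g"
    using compl_subset ideal_inter by (auto simp: code_sum_plus)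
  then show "x \<in> gen_ideal p g"
    by (simp add: mem_g conv_add_left)
qed

text \<open>The sum is direct: \<open>x h = 0\<close> forces \<open>x J = 0\<close>, while
  \<open>x J = x\<close> on \<open>(J)\<close>.\<close>

lemma card_ideal: "card (gen_ideal p g) = card (gen_ideal p (dirac - h)) * card (gen_ideal p J)"
  unfolding ideal_decomp
  by (intro card_code_sum gen_ideal_diff) (auto simp: mem_compl_h mem_J conv_J(2))

text \<open>The complementary idempotents \<open>h\<close> and \<open>1 - h\<close> split every
  \<open>x\<close> uniquely.\<close>

lemma card_Rp_eq: "card (Rp p) = card (gen_ideal p (dirac - h)) * card (gen_ideal p h)"
proof -
  have "Rp p = code_sum (gen_ideal p (dirac - h)) (gen_ideal p h)"
  proof (intro equalityI subsetI)
    fix x assume x: "x \<in> Rp p"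
    have "x = (x - conv p x h) + conv p x h" by simp
    moreover have "x - conv p x h \<in> gen_ideal p (dirac - h)" "conv p x h \<in> gen_ideal p h"
      using x by (simp_all add: mem_compl_h mem_h conv_diff_left conv_assoc hh)
    ultimately show "x \<in> code_sum (gen_ideal p (dirac - h)) (gen_ideal p h)"
      unfolding code_sum_plus by blast
  qed (auto simp: code_sum_plus mem_compl_h mem_h)
  also have "card \<dots> = card (gen_ideal p (dirac - h)) * card (gen_ideal p h)"
    by (intro card_code_sum gen_ideal_diff) (auto simp: mem_compl_h mem_h)
  finally show ?thesis .
qed

end

section \<open>The quadratic residue codes\<close>

lemma bij_Rv: "bij_betw (\<lambda>(a, b). Rv a b) UNIV UNIV"
  by (rule bij_betw_byWitness[where f' = "\<lambda>x. (rv_fst x, rv_snd x)"]) (auto simp: Rv_eq_iff)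

lemma card_Rv: "card (UNIV :: Rv set) = 16"
  using bij_betw_same_card[OF bij_Rv] by simp

lemma card_Rp: "card (Rp p) = 16 ^ p"
proof -
  have "bij_betw (\<lambda>f. restrict f {..<p}) (Rp p) ({..<p} \<rightarrow>\<^sub>E UNIV)"
    \<comment> \<open>\<open>Rp\<close> pads with 0 beyond \<open>p\<close>, extensional functions
      with \<open>undefined\<close>.\<close>
    by (rule bij_betw_byWitness[where f' = "\<lambda>f k. if k < p then f k else 0"])
      (auto simp: Rp_def fun_eq_iff PiE_def extensional_def)
  then show ?thesis
    by (simp add: bij_betw_same_card card_funcsetE card_Rv)
qed

lemma four_Rv: "(4 :: Rv) = 0"
proof -
  have "(4 :: Rv) = (1 + 1) + (1 + 1)" by simp
  also have "\<dots> = 0" by (simp add: Rv_eq_iff one_Rv_def zero_Rv_def plus_Rv_def)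
  finally show ?thesis .
qed

lemma of_nat_Rv: "(of_nat n :: Rv) = of_nat (n mod 4)"
proof -
  have "(of_nat (4 * (n div 4) + n mod 4) :: Rv) = of_nat (n mod 4)"
    by (simp only: of_nat_add of_nat_mult of_nat_numeral four_Rv) simp
  then show ?thesis by simp
qed

text \<open>Multiples of a constant vector are constant, and -1 is a unit, so all 16 constants
  occur. The generator will turn out to be J.\<close>

lemma card_gen_const:
  assumes "0 < p"
  shows "card (gen_ideal p (\<lambda>k. if k < p then -1 else 0)) = 16"
proof -
  let ?c = "\<lambda>c k. if k < p then c else 0 :: Rv"
  have "gen_ideal p (?c (-1)) = range ?c"
  proof (intro equalityI subsetI)
    fix x assume "x \<in> range ?c"
    then obtain c where c: "x = ?c c" by blast
    have "conv p (\<lambda>k. - c * dirac k) (?c (-1)) = x"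
      unfolding conv_const_right c using assms by (auto simp: dirac_def sum_distrib_left[symmetric] sum_negf)
    moreover have "(\<lambda>k. - c * dirac k) \<in> Rp p"
      using assms by (simp add: Rp_def dirac_def)
    ultimately show "x \<in> gen_ideal p (?c (-1))"
      unfolding gen_ideal_conv by blast
  qed (auto simp: gen_ideal_conv conv_const_right)
  moreover have "inj ?c"
    using assms by (auto simp: inj_def fun_eq_iff)
  ultimately show ?thesis
    by (simp add: card_image card_Rv)
qed

lemma two_Rv: "2 = Rv 2 0"
proof -
  have "(2 :: Rv) = 1 + 1" by simp
  then show ?thesis by (simp add: one_Rv_def plus_Rv_def)
qed

lemmas Rv_ops = zero_Rv_def one_Rv_def two_Rv plus_Rv_def minus_Rv_def uminus_Rv_def times_Rv_def vv_def

text \<open>Every generator is of this form or \<open>dirac\<close> minus such a one; dilation by a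
  non-residue exchanges \<open>a\<close> and \<open>b\<close>.\<close>

definition comb :: "nat \<Rightarrow> Rv \<Rightarrow> Rv \<Rightarrow> nat \<Rightarrow> Rv" where
  "comb p a b = (\<lambda>k. a * chi (QR p) k + b * chi (NR p) k)"

context prime_3_mod_4
begin

lemma comb_Rp: "comb p a b \<in> Rp p"
  by (simp add: comb_def Rp_iff chi_outside)

lemma dil_comb:
  "a \<in> QR p \<Longrightarrow> dil p a (comb p x y) = comb p x y"
  "a \<in> NR p \<Longrightarrow> dil p a (comb p x y) = comb p y x"
proof -
  have split: "comb p x y = (\<lambda>k. x * chi (QR p) k) + (\<lambda>k. y * chi (NR p) k)" for x y
    by (simp add: fun_eq_iff comb_def)
  show "a \<in> QR p \<Longrightarrow> dil p a (comb p x y) = comb p x y"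
    by (simp only: split dil_add dil_smult dil_QR)
  show "a \<in> NR p \<Longrightarrow> dil p a (comb p x y) = comb p y x"
    by (simp only: split dil_add dil_smult dil_NR add.commute)
qed

lemma dirac_QR_NR: "dirac k + chi (QR p) k + chi (NR p) k = (if k < p then 1 else 0)"
proof -
  consider "p \<le> k" | "k = 0" | "k \<in> QR p" | "k \<in> NR p"
    using NR_iff[of k] by fastforce
  then show ?thesis
    using p_gt_2 zero_notin QR_lt[of k] NR_lt[of k] QR_NR_disjoint[of k]
    by cases (auto simp: chi_outside dirac_outside, auto simp: dirac_def chi_def)
qed

lemma Jpol_eq: "Jpol p = (\<lambda>k. if k < p then -1 else 0)"
proof -
  have "(of_nat p :: Rv) = of_nat 3"
    using p_mod_4 of_nat_Rv[of p] by simp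
  also have "\<dots> = 4 - 1" by simp
  finally show ?thesis by (simp add: Jpol_def four_Rv cong: if_cong)
qed

text \<open>The assumptions are the splitting equations read off coefficientwise from
  \<open>conv_QR_NR_comb\<close>; \<open>2 * (a * b) = 0\<close> kills the mixed terms of the
  squares.\<close>

lemma splitting_comb:
  fixes a b :: Rv
  defines "c \<equiv> of_nat period_const"
  assumes ab: "2 * (a * b) = 0" "a * a + b * b = 1" "a + b = -1"
    and idem: "a * a * c + b * b * (c + 1) = a" "a * a * (c + 1) + b * b * c = b"
    and c: "2 * c + 1 = -1" "c - a * b = -1"
  shows "splitting p (comb p a b) (comb p b a) (Jpol p)"
proof
  have sym: "a * b + b * a = 0" using ab(1) by (simp add: mult.commute algebra_simps)
  have J: "Jpol p = (\<lambda>k. - (dirac k + chi (QR p) k + chi (NR p) k))"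
    by (simp add: Jpol_eq dirac_QR_NR fun_eq_iff)
  show "0 < p" using p_gt_2 by simp
  show "comb p a b \<in> Rp p" "comb p b a \<in> Rp p" by (rule comb_Rp)+
  have idem': "b * b * c + a * a * (c + 1) = b" "b * b * (c + 1) + a * a * c = a"
    using idem by (simp_all add: add.commute)
  show "conv p (comb p a b) (comb p a b) = comb p a b"
    unfolding comb_def conv_QR_NR_comb c_def[symmetric] sym by (simp add: idem)
  show "conv p (comb p b a) (comb p b a) = comb p b a"
    unfolding comb_def conv_QR_NR_comb c_def[symmetric] sym[unfolded add.commute[of "a * b"]]
    by (simp add: idem')
  \<comment> \<open>Both coefficients away from 0 reduce to \<open>c - a * b\<close>, as
    \<open>a * b + b * a\<close> and \<open>2 * (a * b)\<close> vanish.\<close>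
  have "a * b * c + c + b * a * (c + 1) = (a * b + b * a) * c + (c - a * b) + 2 * (a * b)"
    "a * b * (c + 1) + c + b * a * c = (a * b + b * a) * c + (c - a * b) + 2 * (a * b)"
    by (simp_all add: algebra_simps)
  then have off: "a * b * c + c + b * a * (c + 1) = -1" "a * b * (c + 1) + c + b * a * c = -1"
    by (simp_all only: sym ab c) simp_all
  show "conv p (comb p a b) (comb p b a) = Jpol p"
    unfolding comb_def conv_QR_NR_comb c_def[symmetric] ab(2) J c(1) mult_1_left off by simp
  show "comb p a b + comb p b a = dirac + Jpol p"
  proof
    fix k
    have "(comb p a b + comb p b a) k = (a + b) * (chi (QR p) k + chi (NR p) k)"
      by (simp add: comb_def algebra_simps)
    then show "(comb p a b + comb p b a) k = (dirac + Jpol p) k"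
      by (simp add: ab(3) J)
  qed
qed

end

section \<open>The codes for primes congruent to 7 mod 8\<close>

locale prime_7_mod_8 =
  fixes p :: nat
  assumes prime_p: "prime p" and p_mod_8: "p mod 8 = 7"
begin

sublocale prime_3_mod_4 p
proof
  show "prime p" by (rule prime_p)
  show "p mod 4 = 3" using p_mod_8 by presburger
qed

text \<open>With \<open>p = 8r - 1\<close> the constant is \<open>2r - 1\<close>, whose class mod 4
  depends only on the parity of \<open>r\<close>: hence two forms of the generators.\<close>

lemma of_nat_period_const: "(of_nat period_const :: Rv) = (if odd (rr p) then 1 else -1)"
proof -
  have "period_const mod 4 = (if odd (rr p) then 1 else 3)"
  proof -
    obtain q where "p = 8 * q + 7"
      using p_mod_8 by (metis mult_div_mod_eq)
    then have "period_const = 2 * q + 1" "rr p = Suc q"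
      unfolding period_const_def rr_def by simp_all
    then show ?thesis by (simp, presburger)
  qed
  moreover have "(3 :: Rv) = 4 - 1" by simp
  ultimately show ?thesis
    using of_nat_Rv[of period_const] by (simp add: four_Rv)
qed

lemma chi_pols: "Qpol p = chi (QR p)" "Npol p = chi (NR p)"
  by (simp_all add: fun_eq_iff Qpol_def Npol_def chi_def)

text \<open>Both parities of \<open>r\<close> give the same shape, after which only the splitting
  matters.\<close>

lemma generators:
  obtains a b where
    "D1 p = gen_ideal p (comb p a b)" "D2 p = gen_ideal p (comb p b a)"
    "E1 p = gen_ideal p (dirac - comb p b a)" "E2 p = gen_ideal p (dirac - comb p a b)"
    "splitting p (comb p a b) (comb p b a) (Jpol p)"
proof (cases "odd (rr p)")
  case True
  \<comment> \<open>The coefficients of Q and N in the generator of \<open>D1\<close>,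
    collected.\<close>
  let ?a = "2 - vv" and ?b = "1 + vv"
  have c: "of_nat period_const = (1 :: Rv)" using True by (simp add: of_nat_period_const)
  \<comment> \<open>The last two equations rest on 4 = 0 in R.\<close>
  have "vv + (1 - vv) * 2 = ?a" "vv * 2 + (1 - vv) = ?b"
    "vv * 2 - (1 - vv) = - ?b" "(1 - vv) * 2 - vv = - ?a"
    by (unfold Rv_ops, simp_all)
  note k = this
  have "vv * (x + 2 * y) + (1 - vv) * (y + 2 * x)
      = (vv + (1 - vv) * 2) * x + (vv * 2 + (1 - vv)) * y" for x y
    by (simp add: algebra_simps)
  then have g: "vv * (x + 2 * y) + (1 - vv) * (y + 2 * x) = ?a * x + ?b * y" for x y
    unfolding k .
  have e: "vv * (d - y + 2 * x) + (1 - vv) * (d - x + 2 * y) = d - (?b * x + ?a * y)" for d x y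
  proof -
    have "vv * (d - y + 2 * x) + (1 - vv) * (d - x + 2 * y)
        = d + ((vv * 2 - (1 - vv)) * x + ((1 - vv) * 2 - vv) * y)"
      by (simp add: algebra_simps)
    also have "\<dots> = d + (- ?b * x + - ?a * y)"
      by (simp only: k)
    finally show ?thesis
      by (simp add: algebra_simps)
  qed
  show ?thesis
  proof (rule that)
    show "D1 p = gen_ideal p (comb p ?a ?b)" "D2 p = gen_ideal p (comb p ?b ?a)"
      unfolding D1_def D2_def Let_def if_P[OF True] g comb_def chi_pols
      by (simp_all only: add.commute)
    show "E1 p = gen_ideal p (dirac - comb p ?b ?a)" "E2 p = gen_ideal p (dirac - comb p ?a ?b)"
      unfolding E1_def E2_def Let_def if_P[OF True] e comb_def chi_pols onep_dirac fun_diff_def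
      by (simp_all only: add.commute)
    show "splitting p (comb p ?a ?b) (comb p ?b ?a) (Jpol p)"
      by (rule splitting_comb; unfold c Rv_ops; simp)
  qed
next
  case False
  \<comment> \<open>The coefficients of Q and N as they stand; \<open>?a * ?b = 0\<close> since
    \<open>vv\<close> is idempotent.\<close>
  let ?a = "- vv" and ?b = "vv - 1"
  have c: "of_nat period_const = (-1 :: Rv)" using False by (simp add: of_nat_period_const)
  have g: "- vv * x - (1 - vv) * y = ?a * x + ?b * y" for x y
    by (simp add: algebra_simps)
  have e: "vv * (d + y) + (1 - vv) * (d + x) = d - (?b * x + ?a * y)" for d x y
    by (simp add: algebra_simps)
  show ?thesis
  proof (rule that)
    show "D1 p = gen_ideal p (comb p ?a ?b)" "D2 p = gen_ideal p (comb p ?b ?a)"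
      unfolding D1_def D2_def Let_def if_not_P[OF False] g comb_def chi_pols
      by (simp_all only: add.commute)
    show "E1 p = gen_ideal p (dirac - comb p ?b ?a)" "E2 p = gen_ideal p (dirac - comb p ?a ?b)"
      unfolding E1_def E2_def Let_def if_not_P[OF False] e comb_def chi_pols onep_dirac fun_diff_def
      by (simp_all only: add.commute)
    show "splitting p (comb p ?a ?b) (comb p ?b ?a) (Jpol p)"
      by (rule splitting_comb; unfold c Rv_ops; simp)
  qed
qed

end

theorem theorem18:
  fixes p :: nat
  assumes "prime p" and "p mod 8 = 7"
  shows
    "(\<forall>a\<in>QR p. mu p a ` D1 p = D1 p \<and> mu p a ` D2 p = D2 p \<and>
                mu p a ` E1 p = E1 p \<and> mu p a ` E2 p = E2 p)
   \<and> (\<forall>a\<in>NR p. mu p a ` D1 p = D2 p \<and> mu p a ` E1 p = E2 p)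
   \<and> D1 p \<inter> D2 p = gen_ideal p (Jpol p) \<and> code_sum (D1 p) (D2 p) = Rp p
   \<and> E1 p \<inter> E2 p = {\<lambda>_. 0} \<and> code_sum (E1 p) (E2 p) = dual p (gen_ideal p (Jpol p))
   \<and> card (D1 p) = 4 ^ (p + 1) \<and> card (D2 p) = 4 ^ (p + 1)
   \<and> card (E1 p) = 4 ^ (p - 1) \<and> card (E2 p) = 4 ^ (p - 1)
   \<and> D1 p = code_sum (E1 p) (gen_ideal p (Jpol p))
   \<and> D2 p = code_sum (E2 p) (gen_ideal p (Jpol p))
   \<and> self_orthogonal p (E1 p) \<and> self_orthogonal p (E2 p)
   \<and> dual p (E1 p) = D1 p \<and> dual p (E2 p) = D2 p"
proof -
  interpret prime_7_mod_8 p
    using assms by unfold_locales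
  obtain a b where gens:
    "D1 p = gen_ideal p (comb p a b)" "D2 p = gen_ideal p (comb p b a)"
    "E1 p = gen_ideal p (dirac - comb p b a)" "E2 p = gen_ideal p (dirac - comb p a b)"
    and split: "splitting p (comb p a b) (comb p b a) (Jpol p)"
    by (rule generators)
  let ?g = "comb p a b" and ?h = "comb p b a"
  interpret S: splitting p ?g ?h "Jpol p" by (rule split)
  interpret S': splitting p ?h ?g "Jpol p" by (rule S.swap)
  have gen_dil: "mu p u ` gen_ideal p f = gen_ideal p (dil p u f)" "dil p u dirac = dirac"
    if "0 < u" "u < p" for u and f :: "nat \<Rightarrow> Rv"
    using that coprime_p S.p_pos by (simp_all add: mu_dil dil_image_gen_ideal dil_dirac)
  have QR_inv: "mu p u ` D1 p = D1 p \<and> mu p u ` D2 p = D2 p \<and> mu p u ` E1 p = E1 p \<and> mu p u ` E2 p = E2 p"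
    if "u \<in> QR p" for u
    using QR_lt[OF that] that by (simp add: gens gen_dil dil_diff dil_comb)
  \<comment> \<open>The third conjunct goes beyond the claim; it serves the equality of
    cardinalities.\<close>
  have NR_swap: "mu p u ` D1 p = D2 p \<and> mu p u ` E1 p = E2 p \<and> mu p u ` E2 p = E1 p"
    if "u \<in> NR p" for u
    using NR_lt[OF that] that by (simp add: gens gen_dil dil_diff dil_comb)
  have E_inter: "E1 p \<inter> E2 p = {\<lambda>_. 0}"
    using S.compl_inter by (simp add: gens zero_fun_def)
  have neg: "dil p (p - 1) (comb p x y) = comb p y x" "dil p (p - 1) dirac = (dirac :: nat \<Rightarrow> Rv)" for x y
    using dil_comb(2)[OF minus_one_NR] gen_dil(2)[of "p - 1"] p_gt_2 by simp_all
  \<comment> \<open>J is the product of \<open>?g\<close> and \<open>?h\<close>, which reversal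
    merely exchanges; hence the annihilator of J is the dual of \<open>(J)\<close>.\<close>
  have "dil p (p - 1) (Jpol p) = Jpol p"
    unfolding S.gh[symmetric] dil_conv neg by (rule conv_comm)
  then have E_sum: "code_sum (E1 p) (E2 p) = dual p (gen_ideal p (Jpol p))"
    by (simp only: gens S.compl_sum dual_gen_ideal[OF S.p_pos])
  \<comment> \<open>Reversal takes \<open>1 - h\<close> to \<open>1 - g\<close>, and
    \<open>x (1 - g) = 0\<close> says that \<open>x\<close> lies in \<open>(g)\<close>.\<close>
  have dual_E: "dual p (E1 p) = D1 p" "dual p (E2 p) = D2 p"
    by (auto simp only: gens dual_gen_ideal[OF S.p_pos] dil_diff neg S.mem_g S.mem_h
        S.conv_compl right_minus_eq)
  have so: "self_orthogonal p (E1 p)" "self_orthogonal p (E2 p)"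
    unfolding self_orthogonal_def dual_E unfolding gens
    by (rule S.compl_subset S'.compl_subset)+
  have D_decomp: "D1 p = code_sum (E1 p) (gen_ideal p (Jpol p))"
    "D2 p = code_sum (E2 p) (gen_ideal p (Jpol p))"
    by (simp_all only: gens S.ideal_decomp S'.ideal_decomp)
  have card_J: "card (gen_ideal p (Jpol p)) = 16"
    using card_gen_const[OF S.p_pos] by (simp only: Jpol_eq)
  have card_D: "card (D1 p) = card (E1 p) * 16" "card (D2 p) = card (E2 p) * 16"
    by (simp_all only: gens S.card_ideal S'.card_ideal card_J)
  have "finite (Rp p)"
    using card_Rp[of p] by (intro card_ge_0_finite) simp
  then have "finite (E1 p)" "finite (E2 p)"
    unfolding gens using gen_ideal_Rp finite_subset by blast+
  \<comment> \<open>Reversal maps each of the two finite codes onto the other, which gives both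
    inequalities.\<close>
  then have "card (E1 p) = card (E2 p)"
    using NR_swap[OF minus_one_NR] card_image_le by (metis le_antisym)
  moreover have "16 ^ p = card (E1 p) * card (D2 p)"
    using S.card_Rp_eq by (simp only: card_Rp gens)
  \<comment> \<open>\<open>D2\<close> is 16 times as large as \<open>E2\<close>, so the size of the
    ring fixes the square of the size of \<open>E1\<close>.\<close>
  ultimately have "16 * (card (E1 p))\<^sup>2 = 16 ^ p"
    by (simp add: card_D power2_eq_square)
  also have "(16 :: nat) ^ p = 16 * (4 ^ (p - 1))\<^sup>2"
    using S.p_pos by (cases p) (simp_all add: power2_eq_square flip: power_mult_distrib)
  finally have "(card (E1 p))\<^sup>2 = (4 ^ (p - 1))\<^sup>2" by simp
  then have card_E: "card (E1 p) = 4 ^ (p - 1)" "card (E2 p) = 4 ^ (p - 1)"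
    using \<open>card (E1 p) = card (E2 p)\<close> by (simp_all add: power2_eq_iff_nonneg)
  have "(4 :: nat) ^ (p - 1) * 16 = 4 ^ (p + 1)"
    using S.p_pos by (cases p) simp_all
  then have card_D': "card (D1 p) = 4 ^ (p + 1)" "card (D2 p) = 4 ^ (p + 1)"
    by (simp_all only: card_D card_E)
  have D_inter: "D1 p \<inter> D2 p = gen_ideal p (Jpol p)" and D_sum: "code_sum (D1 p) (D2 p) = Rp p"
    by (simp_all only: gens S.ideal_inter S.ideal_sum)
  show ?thesis
    by (intro conjI ballI) (simp_all only: QR_inv NR_swap D_inter D_sum E_inter E_sum card_D' card_E so dual_E
      D_decomp[symmetric])
qed

end
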